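(* Let $G$ be a simple connected graph on $[n]$ such that its Laplacian simplex $\mathcal{P}_G$ is reflexive. Let $\mathcal{W}(G)$ be the whiskered graph on $[2n]$ and $L\in\mathbb{Z}^{2n\times 2n}$ its Laplacian matrix, and let $L(n)$ denote $L$ with its $n$-th column deleted. Then the set of lattice points in the fundamental parallelepiped of the simplex $\mathrm{conv}(\text{rows of } L(n))$ equals \[ \left\{(\lambda,\lambda)\cdot[L(n)\mid\mathbb{1}],\ \left((\lambda,\lambda)+\tfrac{1}{2n}\mathbb{1}\right)\cdot[L(n)\mid\mathbb{1}]\;\middle|\;\lambda\in\Lambda(\mathcal{P}_G)\right\}. \]
   Context: The Laplacian matrix $L$ of a simple graph on $[m]$ has $L_{ii}=\deg(i)$, $L_{ij}=-1$ if $\{i,j\}$ is an edge and $0$ otherwise. For a graph on $[m]$, the Laplacian simplex $\mathcal{P}_G$ is the convex hull in $\mathbb{R}^{m-1}$ of the rows of the Laplacian with its $m$-th column deleted. A lattice polytope is reflexive if it contains the origin in its interior and its dual is a lattice polytope. The whiskered graph $\mathcal{W}(G)$ has vertex set $[2n]$ and edge set $E(G)\cup\{\{i,i+n\}: i\in[n]\}$. $[M\mid\mathbb{1}]$ denotes $M$ with a column of ones appended. For a lattice simplex with ordered vertices $\mathbf{v}_1,\dots,\mathbf{v}_{d+1}\in\mathbb{Z}^d$, the fundamental parallelepiped is $\{\sum_i\lambda_i(\mathbf{v}_i,1)\mid 0\le\lambda_i<1\}$, and $\Lambda(\mathcal{P})$ is the set of $\lambda\in[0,1)^{d+1}$ with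 $\sum_i\lambda_i(\mathbf{v}_i,1)\in\mathbb{Z}^{d+1}$ (here with vertices the rows of the relevant matrix in order). *)

theory Defs
  imports "Jordan_Normal_Form.Matrix"
begin

(* The ambient dimensions n - 1 and 2n - 1 are related and may be 0, so points of R^d are
   the elements of carrier_vec d rather than of a type indexed by the dimension.
   Indices start at 0: the vertex set [m] becomes {0..<m}, and row or column k of a matrix
   (1-based) becomes index k - 1. *)

definition simple_graph :: "nat \<Rightarrow> nat set set \<Rightarrow> bool" where
  "simple_graph m E \<longleftrightarrow> (\<forall>e\<in>E. e \<subseteq> {0..<m} \<and> card e = 2)"

definition connected_graph :: "nat \<Rightarrow> nat set set \<Rightarrow> bool" where
  "connected_graph m E \<longleftrightarrow>
     (\<forall>u\<in>{0..<m}. \<forall>v\<in>{0..<m}. (u, v) \<in> {(x, y). {x, y} \<in> E}\<^sup>*)"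

definition degree :: "nat set set \<Rightarrow> nat \<Rightarrow> nat" where
  "degree E i = card {e \<in> E. i \<in> e}"

definition laplacian :: "nat \<Rightarrow> nat set set \<Rightarrow> int mat" where
  "laplacian m E = mat m m (\<lambda>(i, j).
     if i = j then int (degree E i) else if {i, j} \<in> E then -1 else 0)"

definition whiskered :: "nat \<Rightarrow> nat set set \<Rightarrow> nat set set" where
  "whiskered n E = E \<union> {{i, i + n} | i. i \<in> {0..<n}}"

definition delete_column :: "'a mat \<Rightarrow> nat \<Rightarrow> 'a mat" where
  "delete_column A k = mat (dim_row A) (dim_col A - 1)
     (\<lambda>(i, j). A $$ (i, if j < k then j else Suc j))"

definition append_ones :: "'a :: one mat \<Rightarrow> 'a mat" where
  "append_ones A = mat (dim_row A) (dim_col A + 1)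
     (\<lambda>(i, j). if j < dim_col A then A $$ (i, j) else 1)"

definition row_mult :: "'a :: comm_semiring_0 vec \<Rightarrow> 'a mat \<Rightarrow> 'a vec" (infixl "\<^sub>v*" 70) where
  "x \<^sub>v* A = transpose_mat A *\<^sub>v x"

text \<open>The hull \<open>convex_vec d hull S\<close> is the convex hull of \<open>S\<close> in $R^d$ for
  \<open>S \<subseteq> carrier_vec d\<close>.\<close>

definition convex_vec :: "nat \<Rightarrow> real vec set \<Rightarrow> bool" where
  "convex_vec d C \<longleftrightarrow> C \<subseteq> carrier_vec d \<and>
     (\<forall>x\<in>C. \<forall>y\<in>C. \<forall>u\<ge>0. \<forall>v\<ge>0. u + v = 1 \<longrightarrow> u \<cdot>\<^sub>v x + v \<cdot>\<^sub>v y \<in> C)"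

definition interior_vec :: "nat \<Rightarrow> real vec set \<Rightarrow> real vec set" where
  "interior_vec d S = {p \<in> carrier_vec d. \<exists>\<epsilon>>0. \<forall>x\<in>carrier_vec d.
     sqrt ((x - p) \<bullet> (x - p)) < \<epsilon> \<longrightarrow> x \<in> S}"

definition integer_lattice :: "nat \<Rightarrow> real vec set" where
  "integer_lattice d = {x \<in> carrier_vec d. \<forall>i<d. x $ i \<in> \<int>}"

definition lattice_polytope :: "nat \<Rightarrow> real vec set \<Rightarrow> bool" where
  "lattice_polytope d P \<longleftrightarrow>
     (\<exists>V. finite V \<and> V \<subseteq> integer_lattice d \<and> P = convex_vec d hull V)"

definition dual_polytope :: "nat \<Rightarrow> real vec set \<Rightarrow> real vec set" where
  "dual_polytope d P = {y \<in> carrier_vec d. \<forall>x\<in>P. x \<bullet> y \<le> 1}"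

definition reflexive_polytope :: "nat \<Rightarrow> real vec set \<Rightarrow> bool" where
  "reflexive_polytope d P \<longleftrightarrow> lattice_polytope d P \<and> 0\<^sub>v d \<in> interior_vec d P \<and>
     lattice_polytope d (dual_polytope d P)"

text \<open>Both notions below depend on the order of the vertices, so they take the matrix whose
  rows are the vertices \<open>v\<^sub>i\<close>; the rows of \<open>append_ones M\<close> are the vectors \<open>(v\<^sub>i, 1)\<close>.\<close>

definition rows_conv :: "int mat \<Rightarrow> real vec set" where
  "rows_conv M = convex_vec (dim_col M) hull set (rows (map_mat real_of_int M))"

definition homogenized :: "int mat \<Rightarrow> real mat" where
  "homogenized M = map_mat real_of_int (append_ones M)"

definition half_open_cube :: "nat \<Rightarrow> real vec set" where
  "half_open_cube k = {x \<in> carrier_vec k. \<forall>i<k. 0 \<le> x $ i \<and> x $ i < 1}"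

definition fundamental_parallelepiped :: "int mat \<Rightarrow> real vec set" where
  "fundamental_parallelepiped M =
     {x \<^sub>v* homogenized M | x. x \<in> half_open_cube (dim_row M)}"

definition Lambda :: "int mat \<Rightarrow> real vec set" where
  "Lambda M = {x \<in> half_open_cube (dim_row M).
     x \<^sub>v* homogenized M \<in> integer_lattice (dim_col M + 1)}"

definition laplacian_simplex_matrix :: "nat \<Rightarrow> nat set set \<Rightarrow> int mat" where
  "laplacian_simplex_matrix m E = delete_column (laplacian m E) (m - 1)"

definition laplacian_simplex :: "nat \<Rightarrow> nat set set \<Rightarrow> real vec set" where
  "laplacian_simplex m E = rows_conv (laplacian_simplex_matrix m E)"

end

(*
  In block form the Laplacian of the whiskered graph is [[L + I, -I], [-I, I]], where L is the
  Laplacian of G. The last n columns force coefficients (a, b) in [0,1)^(2n) of a lattice point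
  to satisfy a = b; the other conditions then say that a is integral against L without its last
  column and that 2 * sum a is an integer. So sum a is an integer, and a lies in Lambda(P_G), or
  it is a half-integer, and a should be a translate by 1/(2n) of an element of Lambda(P_G), since
  the columns of L sum to zero. Reflexivity ensures that this translation does not leave [0,1)^n:
  pairing a with the integral dual vertex w_i, where v_j . w_i = 1 for j ~= i and
  v_i . w_i = 1 - n, shows that n * a_i - sum a is an integer.
*)

theory Submission
  imports Defs "Jordan_Normal_Form.Determinant"
begin

section \<open>Coordinates and integrality of coefficient combinations\<close>

lemma sum_lessThan_add:
  fixes f :: "nat \<Rightarrow> 'a :: comm_monoid_add"
  shows "(\<Sum>i<n + m. f i) = (\<Sum>i<n. f i) + (\<Sum>i<m. f (n + i))"
  by (induction m) (auto simp: add.assoc)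

lemma row_mult_homogenized_index:
  assumes "x \<in> carrier_vec (dim_row M)" "j \<le> dim_col M"
  shows "(x \<^sub>v* homogenized M) $ j =
    (if j < dim_col M then \<Sum>i<dim_row M. x $ i * real_of_int (M $$ (i, j))
     else \<Sum>i<dim_row M. x $ i)"
  using assms
  by (auto simp: row_mult_def homogenized_def append_ones_def scalar_prod_def
      atLeast0LessThan mult.commute intro!: sum.cong)

text \<open>The appended column of ones turns the last coordinate into the coefficient sum. All
  lattice conditions below are read off in this form.\<close>

lemma row_mult_homogenized_integral_iff:
  assumes x: "x \<in> carrier_vec (dim_row M)"
  shows "x \<^sub>v* homogenized M \<in> integer_lattice (dim_col M + 1) \<longleftrightarrow>
    (\<forall>j<dim_col M. (\<Sum>i<dim_row M. x $ i * real_of_int (M $$ (i, j))) \<in> \<int>) \<and>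
    (\<Sum>i<dim_row M. x $ i) \<in> \<int>"
proof -
  have "x \<^sub>v* homogenized M \<in> carrier_vec (dim_col M + 1)"
    by (simp add: row_mult_def homogenized_def append_ones_def carrier_dim_vec)
  moreover have "(\<forall>j<dim_col M + 1. Q j) \<longleftrightarrow> (\<forall>j<dim_col M. Q j) \<and> Q (dim_col M)" for Q
    by (auto simp: less_Suc_eq)
  ultimately show ?thesis
    using row_mult_homogenized_index[OF x] by (simp add: integer_lattice_def)
qed

lemma set_rows: "set (rows A) = row A ` {..<dim_row A}"
  by (simp add: rows_def atLeast0LessThan)

section \<open>Linear functionals on convex hulls and lattice polytopes\<close>

lemma convex_vec_linear_le:
  assumes "v \<in> carrier_vec d"
  shows "convex_vec d {x \<in> carrier_vec d. v \<bullet> x \<le> (c :: real)}"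
  unfolding convex_vec_def
proof (intro conjI ballI allI impI)
  fix x y :: "real vec" and s t :: real
  assume xy: "x \<in> {x \<in> carrier_vec d. v \<bullet> x \<le> c}" "y \<in> {x \<in> carrier_vec d. v \<bullet> x \<le> c}"
    and st: "0 \<le> s" "0 \<le> t" "s + t = 1"
  have "v \<bullet> (s \<cdot>\<^sub>v x + t \<cdot>\<^sub>v y) = s * (v \<bullet> x) + t * (v \<bullet> y)"
    using assms xy by (simp add: scalar_prod_add_distrib[of _ d])
  also have "\<dots> \<le> s * c + t * c"
    using xy st by (intro add_mono mult_left_mono) auto
  also have "\<dots> = c"
    using st by (metis distrib_right mult_1)
  finally show "s \<cdot>\<^sub>v x + t \<cdot>\<^sub>v y \<in> {x \<in> carrier_vec d. v \<bullet> x \<le> c}"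
    using xy by simp
qed auto

lemma convex_vec_hull_linear_le:
  assumes "v \<in> carrier_vec d" "S \<subseteq> carrier_vec d" "\<And>x. x \<in> S \<Longrightarrow> v \<bullet> x \<le> (c :: real)"
    and "y \<in> convex_vec d hull S"
  shows "v \<bullet> y \<le> c"
proof -
  have "convex_vec d hull S \<subseteq> {x \<in> carrier_vec d. v \<bullet> x \<le> c}"
    using assms by (intro hull_minimal convex_vec_linear_le) auto
  then show ?thesis
    using assms(4) by auto
qed

text \<open>A linear functional on a polytope is bounded by its maximum over the generators, and
  these are integral here. Integrality of the dual polytope enters through this fact: a real point
  attaining a bound can be replaced by a lattice point attaining it.\<close>

lemma lattice_point_maximizes:
  assumes P: "lattice_polytope d P" and v: "v \<in> carrier_vec d" and y: "y \<in> P"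
  obtains w where "w \<in> P" "w \<in> integer_lattice d" "v \<bullet> y \<le> v \<bullet> w"
proof -
  obtain V where V: "finite V" "V \<subseteq> integer_lattice d" "P = convex_vec d hull V"
    using P by (auto simp: lattice_polytope_def)
  have VP: "V \<subseteq> P"
    unfolding V(3) by (rule hull_subset)
  have Vc: "V \<subseteq> carrier_vec d"
    using V(2) by (auto simp: integer_lattice_def)
  \<comment> \<open>\<open>Max\<close> is meaningful only on a nonempty set. The hull of the empty
    set is empty, which the point \<open>y\<close> excludes.\<close>
  have "V \<noteq> {}"
  proof
    assume "V = {}"
    moreover have "convex_vec d {}"
      by (simp add: convex_vec_def)
    ultimately show False
      using y hull_minimal[of "{}" "{}" "convex_vec d"] V(3) by auto
  qed
  have fin: "finite ((\<lambda>w. v \<bullet> w) ` V)" and ne: "(\<lambda>w. v \<bullet> w) ` V \<noteq> {}"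
    using V(1) \<open>V \<noteq> {}\<close> by auto
  obtain w where w: "w \<in> V" "Max ((\<lambda>w. v \<bullet> w) ` V) = v \<bullet> w"
    using Max_in[OF fin ne] by auto
  have "v \<bullet> y \<le> v \<bullet> w"
    using convex_vec_hull_linear_le[OF v Vc, of "v \<bullet> w" y] y V(3) Max_ge[OF fin] w(2) by auto
  then show thesis
    using that w(1) VP V(2) by blast
qed

text \<open>If \<open>y\<close> were nonzero, a small positive multiple of it would lie in the hull,
  on which \<open>y\<close> pairs nonpositively, while \<open>y\<close> pairs positively with
  itself. An interior origin thus forces the generators to span the space, which makes the vertex
  matrices below nonsingular.\<close>

lemma interior_imp_orthogonal_eq_0:
  assumes S: "S \<subseteq> carrier_vec d" and int: "0\<^sub>v d \<in> interior_vec d (convex_vec d hull S)"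
    and y: "y \<in> carrier_vec d" and orth: "\<And>x. x \<in> S \<Longrightarrow> y \<bullet> x = 0"
  shows "y = 0\<^sub>v d"
proof (rule ccontr)
  assume "y \<noteq> 0\<^sub>v d"
  \<comment> \<open>Conjugation is trivial on real vectors, so positivity of the conjugate square is
    positivity of \<open>y \<bullet> y\<close>.\<close>
  have "conjugate y = y"
    by (rule eq_vecI) auto
  then have pos: "0 < y \<bullet> y"
    using conjugate_square_greater_0_vec[OF y] \<open>y \<noteq> 0\<^sub>v d\<close> by simp
  obtain e where e: "e > 0" and ball: "\<And>x. x \<in> carrier_vec d \<Longrightarrow>
      sqrt ((x - 0\<^sub>v d) \<bullet> (x - 0\<^sub>v d)) < e \<Longrightarrow> x \<in> convex_vec d hull S"
    using int by (auto simp: interior_vec_def)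
  \<comment> \<open>This factor scales \<open>y\<close> to norm \<open>e / 2\<close>, inside the
    ball of radius \<open>e\<close>.\<close>
  define t where "t = e / (2 * sqrt (y \<bullet> y))"
  have t: "t > 0"
    using e pos by (simp add: t_def)
  have "sqrt ((t \<cdot>\<^sub>v y) \<bullet> (t \<cdot>\<^sub>v y)) = t * sqrt (y \<bullet> y)"
    using y t by (simp add: real_sqrt_mult)
  also have "\<dots> < e"
    using e pos by (simp add: t_def)
  finally have "t \<cdot>\<^sub>v y \<in> convex_vec d hull S"
    using y by (intro ball) auto
  then have "y \<bullet> (t \<cdot>\<^sub>v y) \<le> 0"
    using convex_vec_hull_linear_le[OF y S] orth by fastforce
  then show False
    using y t pos by (simp add: mult_le_0_iff)
qed

section \<open>Dual vertices of a simplex with vertex sum zero\<close>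

lemma sum_rows_scalar_prod_eq_0:
  assumes M: "M \<in> carrier_mat n d" and zero: "\<And>c. c < d \<Longrightarrow> (\<Sum>j<n. M $$ (j, c)) = 0"
    and y: "y \<in> carrier_vec d"
  shows "(\<Sum>j<n. row (map_mat real_of_int M) j \<bullet> y) = 0"
proof -
  have "(\<Sum>j<n. row (map_mat real_of_int M) j \<bullet> y) =
      (\<Sum>c<d. (\<Sum>j<n. real_of_int (M $$ (j, c))) * y $ c)"
    using M y unfolding scalar_prod_def atLeast0LessThan
    by (subst sum.swap) (auto simp: sum_distrib_right intro!: sum.cong)
  also have "\<dots> = 0"
    using zero by (simp flip: of_int_sum)
  finally show ?thesis .
qed

text \<open>The vectors \<open>y\<close> below are the vertices of the dual simplex; a vertex sum of zero means that
  the origin has barycentric coordinates \<open>1 / n\<close>.\<close>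

lemma simplex_dual_vertex:
  assumes M: "M \<in> carrier_mat (Suc d) d"
    and int: "0\<^sub>v d \<in> interior_vec d (rows_conv M)"
    and zero: "\<And>c. c < d \<Longrightarrow> (\<Sum>j<Suc d. M $$ (j, c)) = 0"
    and i: "i < Suc d"
  defines "v \<equiv> row (map_mat real_of_int M)"
  obtains y where "y \<in> carrier_vec d" "\<And>j. j < Suc d \<Longrightarrow> j \<noteq> i \<Longrightarrow> v j \<bullet> y = 1"
proof -
  have vc: "v j \<in> carrier_vec d" for j
    using M row_carrier[of "map_mat real_of_int M" j] by (simp add: v_def)
  \<comment> \<open>\<open>s\<close> enumerates the row indices other than \<open>i\<close>, so
    \<open>A\<close> is the vertex matrix without row \<open>i\<close>. The dual vertex is the
    solution of \<open>A *\<^sub>v y = 1\<close>, once \<open>A\<close> is known to be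
    invertible.\<close>
  define s where "s k = (if k < i then k else Suc k)" for k
  define A where "A = mat d d (\<lambda>(k, c). real_of_int (M $$ (s k, c)))"
  have A: "A \<in> carrier_mat d d"
    by (simp add: A_def)
  have s: "s k < Suc d" if "k < d" for k
    using that by (simp add: s_def)
  have rowA: "row A k = v (s k)" if "k < d" for k
    using that s[OF that] M by (intro eq_vecI) (auto simp: A_def v_def)
  have surj: "\<exists>k<d. j = s k" if "j < Suc d" "j \<noteq> i" for j
    using that i by (intro exI[of _ "if j < i then j else j - 1"]) (auto simp: s_def)
  \<comment> \<open>A kernel vector of \<open>A\<close> is orthogonal to every vertex except
    possibly \<open>v i\<close>, and by the zero vertex sum to \<open>v i\<close> as well. Since the
    origin is interior, it vanishes.\<close>
  have "det A \<noteq> 0"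
  proof
    assume "det A = 0"
    then obtain y where y: "y \<in> carrier_vec d" "y \<noteq> 0\<^sub>v d" "A *\<^sub>v y = 0\<^sub>v d"
      using det_0_iff_vec_prod_zero[OF A] by auto
    have off: "v j \<bullet> y = 0" if j: "j < Suc d" "j \<noteq> i" for j
    proof -
      obtain k where k: "k < d" "j = s k"
        using surj[OF j] by blast
      have "row A k \<bullet> y = (A *\<^sub>v y) $ k"
        using k A by simp
      then show ?thesis
        using k y rowA by simp
    qed
    have "(\<Sum>j<Suc d. v j \<bullet> y) = 0"
      unfolding v_def using M zero y(1) by (rule sum_rows_scalar_prod_eq_0)
    then have "v i \<bullet> y = 0"
      using off i by (simp add: sum.remove[of "{..<Suc d}" i] del: sum.lessThan_Suc)
    then have all0: "y \<bullet> x = 0" if "x \<in> set (rows (map_mat real_of_int M))" for x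
    proof -
      have "x \<in> v ` {..<Suc d}"
        using that M by (simp add: set_rows v_def del: lessThan_Suc)
      then obtain j where "j < Suc d" "x = v j"
        by blast
      then show ?thesis
        using off \<open>v i \<bullet> y = 0\<close> comm_scalar_prod[OF y(1) vc] by metis
    qed
    have "set (rows (map_mat real_of_int M)) \<subseteq> carrier_vec d"
      using M rows_carrier[of "map_mat real_of_int M"] by auto
    then have "y = 0\<^sub>v d"
      using interior_imp_orthogonal_eq_0[OF _ _ y(1) all0] int M by (auto simp: rows_conv_def)
    then show False
      using y(2) by simp
  qed
  then obtain B where B: "B \<in> carrier_mat d d" "A * B = 1\<^sub>m d"
    using det_non_zero_imp_unit[OF A, of "()"] A
    by (auto simp: Units_def ring_mat_def)
  define y where "y = B *\<^sub>v vec d (\<lambda>_. 1)"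
  have y: "y \<in> carrier_vec d"
    using B by (simp add: y_def)
  have "A *\<^sub>v y = vec d (\<lambda>_. 1)"
    using A B by (simp add: y_def flip: assoc_mult_mat_vec)
  then have "v (s k) \<bullet> y = 1" if "k < d" for k
    using that rowA[OF that] A by (metis carrier_matD(1) index_mult_mat_vec index_vec)
  then show thesis
    using that[OF y] surj by blast
qed

text \<open>The sum \<open>f\<close> of the vertices other than \<open>v i\<close> is at most
  \<open>d\<close> on the dual polytope, with equality only where each of these \<open>d\<close>
  vertices pairs to 1. The real dual vertex attains the bound, hence so does a lattice point of the
  dual. The zero vertex sum then fixes the pairing with \<open>v i\<close>.\<close>

lemma reflexive_simplex_dual_lattice_vertex:
  assumes M: "M \<in> carrier_mat (Suc d) d"
    and refl: "reflexive_polytope d (rows_conv M)"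
    and zero: "\<And>c. c < d \<Longrightarrow> (\<Sum>j<Suc d. M $$ (j, c)) = 0"
    and i: "i < Suc d"
  defines "v \<equiv> row (map_mat real_of_int M)"
  obtains w where "w \<in> integer_lattice d" "\<And>j. j < Suc d \<Longrightarrow> v j \<bullet> w = (if j = i then - real d else 1)"
proof -
  have vc: "v j \<in> carrier_vec d" for j
    using M row_carrier[of "map_mat real_of_int M" j] by (simp add: v_def)
  have rows: "set (rows (map_mat real_of_int M)) = v ` {..<Suc d}"
    using M by (simp add: set_rows v_def del: lessThan_Suc)
  define f where "f = vec d (\<lambda>c. \<Sum>j\<in>{..<Suc d} - {i}. v j $ c)"
  have f: "f \<in> carrier_vec d"
    by (simp add: f_def)
  have f_prod: "f \<bullet> y = (\<Sum>j\<in>{..<Suc d} - {i}. v j \<bullet> y)" if "y \<in> carrier_vec d" for y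
    using that unfolding f_def scalar_prod_def
    by (subst sum.swap) (auto simp: sum_distrib_right simp del: sum.lessThan_Suc intro!: sum.cong)
  have v_sum: "v i \<bullet> y = - (\<Sum>j\<in>{..<Suc d} - {i}. v j \<bullet> y)" if "y \<in> carrier_vec d" for y
  proof -
    have "(\<Sum>j<Suc d. v j \<bullet> y) = 0"
      unfolding v_def using M zero that by (rule sum_rows_scalar_prod_eq_0)
    then show ?thesis
      using i by (simp add: sum.remove[of "{..<Suc d}" i] del: sum.lessThan_Suc)
  qed
  obtain y where y: "y \<in> carrier_vec d" "\<And>j. j < Suc d \<Longrightarrow> j \<noteq> i \<Longrightarrow> v j \<bullet> y = 1"
    using simplex_dual_vertex[OF M _ zero i] refl
    unfolding v_def reflexive_polytope_def by metis
  have card: "card ({..<Suc d} - {i}) = d"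
    using i by simp
  \<comment> \<open>A half-space that contains the vertices contains their hull, so the dual is cut
    out by the inequalities at the vertices alone.\<close>
  have dual: "dual_polytope d (rows_conv M) = {y \<in> carrier_vec d. \<forall>j<Suc d. v j \<bullet> y \<le> 1}"
  proof -
    have "(\<forall>x\<in>rows_conv M. x \<bullet> z \<le> 1) \<longleftrightarrow> (\<forall>j<Suc d. v j \<bullet> z \<le> 1)"
      if z: "z \<in> carrier_vec d" for z
    proof
      assume "\<forall>x\<in>rows_conv M. x \<bullet> z \<le> 1"
      moreover have "v j \<in> rows_conv M" if "j < Suc d" for j
        unfolding rows_conv_def rows using that by (intro hull_inc) auto
      ultimately show "\<forall>j<Suc d. v j \<bullet> z \<le> 1"
        by blast
    next
      assume le: "\<forall>j<Suc d. v j \<bullet> z \<le> 1"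
      have sub: "rows_conv M \<subseteq> carrier_vec d"
        unfolding rows_conv_def rows using M vc
        by (intro hull_minimal) (auto simp: convex_vec_def)
      have "z \<bullet> x \<le> 1" if "x \<in> rows_conv M" for x
        proof (rule convex_vec_hull_linear_le[OF z])
        show "x \<in> convex_vec d hull (v ` {..<Suc d})"
          using that M unfolding rows_conv_def rows by simp
      qed (use le vc comm_scalar_prod[OF z vc] in auto)
      then show "\<forall>x\<in>rows_conv M. x \<bullet> z \<le> 1"
        using sub comm_scalar_prod[OF z] by (metis subsetD)
    qed
    then show ?thesis
      by (auto simp: dual_polytope_def)
  qed
  have fy: "f \<bullet> y = real d"
    using f_prod[OF y(1)] y(2) card by simp
  \<comment> \<open>Only the inequality at \<open>v i\<close> is still open for \<open>y\<close> to
    lie in the dual; the zero vertex sum settles it.\<close>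
  have "v i \<bullet> y = - real d"
    using v_sum[OF y(1)] f_prod[OF y(1)] fy by simp
  then have "v j \<bullet> y \<le> 1" if "j < Suc d" for j
    using y(2)[OF that] by (cases "j = i") simp_all
  then have "y \<in> dual_polytope d (rows_conv M)"
    using y(1) by (simp add: dual)
  moreover have "lattice_polytope d (dual_polytope d (rows_conv M))"
    using refl by (simp add: reflexive_polytope_def)
  ultimately obtain w where w: "w \<in> dual_polytope d (rows_conv M)" "w \<in> integer_lattice d"
    "real d \<le> f \<bullet> w"
    using lattice_point_maximizes[OF _ f] fy by metis
  have wc: "w \<in> carrier_vec d" and le: "\<And>j. j < Suc d \<Longrightarrow> v j \<bullet> w \<le> 1"
    using w(1) by (auto simp: dual)
  have "f \<bullet> w \<le> real d"
    using sum_bounded_above[of "{..<Suc d} - {i}" "\<lambda>j. v j \<bullet> w" 1] le f_prod[OF wc] card by simp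
  then have fw: "f \<bullet> w = real d"
    using w(3) by simp
  have one: "v j \<bullet> w = 1" if j: "j < Suc d" "j \<noteq> i" for j
  proof -
    have "(\<Sum>j\<in>{..<Suc d} - {i}. 1 - v j \<bullet> w) = 0"
      using fw f_prod[OF wc] card by (simp add: sum_subtractf)
    moreover have "0 \<le> 1 - v j \<bullet> w" if "j \<in> {..<Suc d} - {i}" for j
      using le that by simp
    ultimately have "\<forall>j\<in>{..<Suc d} - {i}. 1 - v j \<bullet> w = 0"
      by (subst (asm) sum_nonneg_eq_0_iff) auto
    then show ?thesis
      using j by auto
  qed
  have "v i \<bullet> w = - real d"
    using v_sum[OF wc] f_prod[OF wc] fw by simp
  then show thesis
    using one by (intro that[OF w(2)]) auto
qed

text \<open>The combination of the vertices with coefficients \<open>a\<close> is an integral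
  vector, so its pairing with the integral dual vertex \<open>w\<close> is an integer, which
  evaluates to the stated difference. The coefficient sum itself may be fractional; this covers the
  half-integral case later on.\<close>

lemma reflexive_simplex_coefficient:
  assumes M: "M \<in> carrier_mat (Suc d) d"
    and refl: "reflexive_polytope d (rows_conv M)"
    and zero: "\<And>c. c < d \<Longrightarrow> (\<Sum>j<Suc d. M $$ (j, c)) = 0"
    and i: "i < Suc d"
    and a: "\<And>c. c < d \<Longrightarrow> (\<Sum>j<Suc d. a j * real_of_int (M $$ (j, c))) \<in> \<int>"
  shows "(\<Sum>j<Suc d. a j) - real (Suc d) * a i \<in> \<int>"
proof -
  define v where "v = row (map_mat real_of_int M)"
  obtain w where w: "w \<in> integer_lattice d"
    "\<And>j. j < Suc d \<Longrightarrow> v j \<bullet> w = (if j = i then - real d else 1)"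
    using reflexive_simplex_dual_lattice_vertex[OF M refl zero i] unfolding v_def by metis
  have wd: "dim_vec w = d"
    using w(1) by (simp add: integer_lattice_def)
  have "(\<Sum>c<d. w $ c * (\<Sum>j<Suc d. a j * real_of_int (M $$ (j, c)))) \<in> \<int>"
    by (rule Ints_sum, rule Ints_mult)
      (use w(1) a in \<open>auto simp: integer_lattice_def simp del: sum.lessThan_Suc\<close>)
  also have "(\<Sum>c<d. w $ c * (\<Sum>j<Suc d. a j * real_of_int (M $$ (j, c)))) =
      (\<Sum>j<Suc d. a j * (\<Sum>c<d. real_of_int (M $$ (j, c)) * w $ c))"
    unfolding sum_distrib_left by (subst sum.swap) (intro sum.cong, auto)
  also have "\<dots> = (\<Sum>j<Suc d. a j * (v j \<bullet> w))"
    using M wd by (intro sum.cong) (auto simp: v_def scalar_prod_def atLeast0LessThan)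
  \<comment> \<open>Writing \<open>- d\<close> as \<open>1 - (d + 1)\<close> separates the full
    coefficient sum from a correction at \<open>i\<close>.\<close>
  also have "\<dots> = (\<Sum>j<Suc d. a j - (if j = i then real (Suc d) * a i else 0))"
    using w(2) by (intro sum.cong) (auto simp: algebra_simps)
  also have "\<dots> = (\<Sum>j<Suc d. a j) - real (Suc d) * a i"
    unfolding sum_subtractf using i by (simp add: sum.delta del: sum.lessThan_Suc)
  finally show ?thesis .
qed

section \<open>Degrees and column sums of the Laplacian\<close>

lemma degree_eq_card_neighbours:
  assumes "simple_graph m E"
  shows "Defs.degree E j = card {i. i < m \<and> i \<noteq> j \<and> {i, j} \<in> E}"
proof -
  \<comment> \<open>Each edge through \<open>j\<close> is counted by its other endpoint.\<close>
  have "bij_betw (\<lambda>i. {i, j}) {i. i < m \<and> i \<noteq> j \<and> {i, j} \<in> E} {e \<in> E. j \<in> e}"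
    unfolding bij_betw_def
  proof
    show "inj_on (\<lambda>i. {i, j}) {i. i < m \<and> i \<noteq> j \<and> {i, j} \<in> E}"
      by (auto simp: inj_on_def doubleton_eq_iff)
    show "(\<lambda>i. {i, j}) ` {i. i < m \<and> i \<noteq> j \<and> {i, j} \<in> E} = {e \<in> E. j \<in> e}"
    proof (intro Set.set_eqI iffI)
      fix e assume e: "e \<in> {e \<in> E. j \<in> e}"
      then have "e \<subseteq> {0..<m}" "card e = 2"
        using assms by (auto simp: simple_graph_def)
      then obtain u v where uv: "e = {u, v}" "u \<noteq> v" "u < m" "v < m"
        by (auto simp: card_2_iff)
      define i where "i = (if u = j then v else u)"
      have "e = {i, j}" "i \<noteq> j" "i < m"
        using uv e by (auto simp: i_def)
      then show "e \<in> (\<lambda>i. {i, j}) ` {i. i < m \<and> i \<noteq> j \<and> {i, j} \<in> E}"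
        using e by auto
    qed auto
  qed
  then show ?thesis
    unfolding Defs.degree_def by (simp add: bij_betw_same_card)
qed

text \<open>The diagonal entry counts exactly the neighbours that contribute -1 to the
  column.\<close>

lemma laplacian_column_sum:
  assumes "simple_graph m E" "j < m"
  shows "(\<Sum>i<m. laplacian m E $$ (i, j)) = 0"
proof -
  have "(\<Sum>i<m. laplacian m E $$ (i, j)) =
      (\<Sum>i<m. (if i = j then int (Defs.degree E j) else 0) - (if i \<noteq> j \<and> {i, j} \<in> E then 1 else 0))"
    using assms(2) by (intro sum.cong) (auto simp: laplacian_def)
  also have "\<dots> = int (Defs.degree E j) - int (card {i. i < m \<and> i \<noteq> j \<and> {i, j} \<in> E})"
    using assms(2) by (simp add: sum_subtractf sum.If_cases Int_def)
  finally show ?thesis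
    using degree_eq_card_neighbours[OF assms(1)] by simp
qed

section \<open>Block form of the whiskered Laplacian\<close>

lemma whiskered_edge_iff:
  assumes "simple_graph n E" "i < n" "j < n"
  shows "{i, j} \<in> whiskered n E \<longleftrightarrow> {i, j} \<in> E"
    and "{n + i, j} \<in> whiskered n E \<longleftrightarrow> i = j"
    and "{i, n + j} \<in> whiskered n E \<longleftrightarrow> i = j"
    and "{n + i, n + j} \<notin> whiskered n E"
  using assms by (force simp: simple_graph_def whiskered_def doubleton_eq_iff)+

lemma whiskered_degree:
  assumes "simple_graph n E" "i < n"
  shows "Defs.degree (whiskered n E) i = Defs.degree E i + 1"
    and "Defs.degree (whiskered n E) (n + i) = 1"
proof -
  \<comment> \<open>Inserting a whisker raises the cardinality by one only for a finite edge set;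
    finiteness comes from the finite vertex set.\<close>
  have fin: "finite E"
    using assms(1) by (intro finite_subset[of E "Pow {0..<n}"]) (auto simp: simple_graph_def)
  have "{e \<in> whiskered n E. i \<in> e} = insert {i, i + n} {e \<in> E. i \<in> e}"
    using assms by (auto simp: whiskered_def)
  moreover have "{i, i + n} \<notin> E"
    using assms(1) by (auto simp: simple_graph_def)
  ultimately show "Defs.degree (whiskered n E) i = Defs.degree E i + 1"
    using fin by (simp add: Defs.degree_def)
  have "n + i \<notin> e" if "e \<in> E" for e
  proof -
    have "e \<subseteq> {0..<n}"
      using assms(1) that by (simp add: simple_graph_def)
    then show ?thesis
      by auto
  qed
  then have "{e \<in> whiskered n E. n + i \<in> e} = {{i, i + n}}"
    using assms(2) by (auto simp: whiskered_def)
  then show "Defs.degree (whiskered n E) (n + i) = 1"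
    by (simp add: Defs.degree_def)
qed

lemma whiskered_laplacian_index:
  assumes "simple_graph n E" "i < n" "j < n"
  shows "laplacian (2 * n) (whiskered n E) $$ (i, j) =
      laplacian n E $$ (i, j) + (if i = j then 1 else 0)"
    and "laplacian (2 * n) (whiskered n E) $$ (n + i, j) = (if i = j then - 1 else 0)"
    and "laplacian (2 * n) (whiskered n E) $$ (i, n + j) = (if i = j then - 1 else 0)"
    and "laplacian (2 * n) (whiskered n E) $$ (n + i, n + j) = (if i = j then 1 else 0)"
  using assms whiskered_degree[OF assms(1)] whiskered_edge_iff[OF assms]
  by (auto simp: laplacian_def)

text \<open>The three conditions come from the first block column, the second block column and the
  column of ones. Deleting index \<open>n - 1\<close> removes one condition of the first family and
  none of the second, so \<open>b\<close> is controlled by \<open>a\<close> in every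
  coordinate.\<close>

lemma whiskered_integral_iff:
  assumes G: "simple_graph n E" and n: "n \<ge> 1"
    and a: "a \<in> carrier_vec n" and b: "b \<in> carrier_vec n"
  defines "Ln \<equiv> delete_column (laplacian (2 * n) (whiskered n E)) (n - 1)"
  shows "(a @\<^sub>v b) \<^sub>v* homogenized Ln \<in> integer_lattice (2 * n) \<longleftrightarrow>
    (\<forall>c<n - 1. (\<Sum>i<n. a $ i * real_of_int (laplacian n E $$ (i, c))) + a $ c - b $ c \<in> \<int>) \<and>
    (\<forall>c<n. b $ c - a $ c \<in> \<int>) \<and> (\<Sum>i<n. a $ i) + (\<Sum>i<n. b $ i) \<in> \<int>"
proof -
  define L where "L = laplacian (2 * n) (whiskered n E)"
  define x where "x = a @\<^sub>v b"
  have x: "x $ i = a $ i" "x $ (n + i) = b $ i" if "i < n" for i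
    using that a b by (auto simp: x_def)
  have x_carrier: "x \<in> carrier_vec (2 * n)"
    unfolding x_def mult_2 using a b by (rule append_carrier_vec)
  have dim: "dim_row Ln = 2 * n" "dim_col Ln = 2 * n - 1"
    by (auto simp: Ln_def delete_column_def laplacian_def)
  \<comment> \<open>Subtraction on naturals is truncated, so \<open>n \<ge> 1\<close> matters
    here.\<close>
  have dim1: "dim_col Ln + 1 = 2 * n"
    using dim n by simp
  define col where "col c = (\<Sum>i<2 * n. x $ i * real_of_int (L $$ (i, c)))" for c
  have col1: "col c = (\<Sum>i<n. a $ i * real_of_int (laplacian n E $$ (i, c))) + a $ c - b $ c"
    if c: "c < n" for c
  proof -
    have "col c = (\<Sum>i<n. a $ i * real_of_int (laplacian n E $$ (i, c)) + (if i = c then a $ i else 0))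
        + (\<Sum>i<n. (if i = c then - b $ i else 0))"
      unfolding col_def L_def mult_2 sum_lessThan_add
      using x whiskered_laplacian_index[OF G _ c, unfolded mult_2]
      by (intro arg_cong2[of _ _ _ _ "(+)"] sum.cong) (auto simp: algebra_simps)
    then show ?thesis
      using c by (simp add: sum.distrib)
  qed
  have col2: "col (n + c) = b $ c - a $ c" if c: "c < n" for c
  proof -
    have "col (n + c) = (\<Sum>i<n. (if i = c then - a $ i else 0)) + (\<Sum>i<n. (if i = c then b $ i else 0))"
      unfolding col_def L_def mult_2 sum_lessThan_add
      using x whiskered_laplacian_index[OF G _ c, unfolded mult_2]
      by (intro arg_cong2[of _ _ _ _ "(+)"] sum.cong) auto
    then show ?thesis
      using c by simp
  qed
  have colLn: "(\<Sum>i<2 * n. x $ i * real_of_int (Ln $$ (i, j))) = col (if j < n - 1 then j else Suc j)"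
    if "j < 2 * n - 1" for j
    using that unfolding col_def L_def
    by (intro sum.cong) (auto simp: Ln_def delete_column_def laplacian_def)
  have total: "(\<Sum>i<2 * n. x $ i) = (\<Sum>i<n. a $ i) + (\<Sum>i<n. b $ i)"
    unfolding mult_2 sum_lessThan_add using x by simp
  \<comment> \<open>The surviving columns are those with indices below \<open>n - 1\<close> and
    those from \<open>n\<close> to \<open>2 * n - 1\<close>.\<close>
  have "(\<forall>j<2 * n - 1. col (if j < n - 1 then j else Suc j) \<in> \<int>) \<longleftrightarrow>
      (\<forall>c<n - 1. col c \<in> \<int>) \<and> (\<forall>c<n. col (n + c) \<in> \<int>)"  (is "?l \<longleftrightarrow> ?r")
  proof
    assume l: ?l
    show ?r
    proof (intro conjI allI impI)
      fix c assume "c < n - 1"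
      then show "col c \<in> \<int>"
        using l[rule_format, of c] by simp
    next
      fix c assume "c < n"
      \<comment> \<open>After the deletion, column \<open>n + c\<close> sits at position
        \<open>n - 1 + c\<close>.\<close>
      then have "n - 1 + c < 2 * n - 1" "\<not> n - 1 + c < n - 1" "Suc (n - 1 + c) = n + c"
        using n by simp_all
      then show "col (n + c) \<in> \<int>"
        using l by metis
    qed
  next
    assume r: ?r
    show ?l
    proof (intro allI impI)
      fix j assume j: "j < 2 * n - 1"
      show "col (if j < n - 1 then j else Suc j) \<in> \<int>"
      proof (cases "j < n - 1")
        case False
        then have "Suc j = n + (Suc j - n)" "Suc j - n < n"
          using j by auto
        then show ?thesis
          using r False by metis
      qed (use r in simp)
    qed
  qed
  then show ?thesis
    using row_mult_homogenized_integral_iff[of x Ln, unfolded dim1, unfolded dim] x_carrier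
      colLn total col1 col2
    unfolding x_def[symmetric] by simp
qed

section \<open>Coefficient vectors in the half-open cube\<close>

lemma half_open_cube_append:
  assumes "x \<in> half_open_cube (n + m)"
  obtains a b where "x = a @\<^sub>v b" "a \<in> half_open_cube n" "b \<in> half_open_cube m"
proof (rule that)
  show "x = vec_first x n @\<^sub>v vec_last x m"
    using assms by (simp add: half_open_cube_def)
  show "vec_first x n \<in> half_open_cube n" "vec_last x m \<in> half_open_cube m"
    using assms by (auto simp: half_open_cube_def vec_first_def vec_last_def)
qed

text \<open>The difference lies strictly between -1 and 1. This turns congruence modulo 1 of the two
  halves of a coefficient vector into equality.\<close>

lemma Ints_eq_of_half_open:
  fixes s t :: real
  assumes "t - s \<in> \<int>" "0 \<le> s" "s < 1" "0 \<le> t" "t < 1"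
  shows "t = s"
proof -
  obtain k where k: "t - s = of_int k"
    using assms(1) by (auto elim: Ints_cases)
  then have "- 1 < k" "k < 1"
    using assms by linarith+
  then show ?thesis
    using k by simp
qed

lemma Lambda_laplacian_iff:
  assumes n: "n \<ge> 1"
  shows "a \<in> Lambda (laplacian_simplex_matrix n E) \<longleftrightarrow> a \<in> half_open_cube n \<and>
    (\<forall>c<n - 1. (\<Sum>i<n. a $ i * real_of_int (laplacian n E $$ (i, c))) \<in> \<int>) \<and> (\<Sum>i<n. a $ i) \<in> \<int>"
proof -
  have dim: "dim_row (laplacian_simplex_matrix n E) = n" "dim_col (laplacian_simplex_matrix n E) = n - 1"
    by (auto simp: laplacian_simplex_matrix_def delete_column_def laplacian_def)
  have ix: "laplacian_simplex_matrix n E $$ (i, c) = laplacian n E $$ (i, c)" if "i < n" "c < n - 1" for i c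
    using that by (simp add: laplacian_simplex_matrix_def delete_column_def laplacian_def)
  show ?thesis
    using row_mult_homogenized_integral_iff[of a "laplacian_simplex_matrix n E"] ix
    by (auto simp: Lambda_def dim half_open_cube_def)
qed

section \<open>Lattice points in the parallelepiped of the whiskered simplex\<close>

theorem theorem3p18:
  fixes n :: nat and E :: "nat set set" and L Ln :: "int mat"
  assumes "n \<ge> 1"
    and "simple_graph n E"
    and "connected_graph n E"
    and "reflexive_polytope (n - 1) (laplacian_simplex n E)"
  defines "L \<equiv> laplacian (2 * n) (whiskered n E)"
  defines "Ln \<equiv> delete_column L (n - 1)"
  shows "fundamental_parallelepiped Ln \<inter> integer_lattice (2 * n) =
    (\<Union>l\<in>Lambda (laplacian_simplex_matrix n E).
       {(l @\<^sub>v l) \<^sub>v* homogenized Ln,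
        ((l @\<^sub>v l) + (1 / (2 * real n)) \<cdot>\<^sub>v vec (2 * n) (\<lambda>_. 1)) \<^sub>v* homogenized Ln})"
proof -
  note n = assms(1) and G = assms(2)
  define M where "M = laplacian_simplex_matrix n E"
  \<comment> \<open>\<open>I\<close> takes a function instead of a vector, so that translates by a
    constant can be written directly.\<close>
  define I where "I a \<longleftrightarrow> (\<forall>c<n - 1. (\<Sum>i<n. a i * real_of_int (laplacian n E $$ (i, c))) \<in> \<int>)"
    for a :: "nat \<Rightarrow> real"
  have M: "M \<in> carrier_mat (Suc (n - 1)) (n - 1)"
    using n by (simp add: M_def laplacian_simplex_matrix_def delete_column_def laplacian_def)
  have ix: "M $$ (i, c) = laplacian n E $$ (i, c)" if "i < n" "c < n - 1" for i c
    using that by (simp add: M_def laplacian_simplex_matrix_def delete_column_def laplacian_def)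
  have refl: "reflexive_polytope (n - 1) (rows_conv M)"
    using assms(4) by (simp add: laplacian_simplex_def M_def)
  have zero: "(\<Sum>j<Suc (n - 1). M $$ (j, c)) = 0" if "c < n - 1" for c
    using laplacian_column_sum[OF G, of c] that n ix by (simp del: sum.lessThan_Suc)
  \<comment> \<open>This is the only consequence of reflexivity used below: every
    \<open>n * a i\<close> is congruent to the coefficient sum modulo 1.\<close>
  have coeff: "(\<Sum>j<n. a j) - real n * a i \<in> \<int>" if "I a" "i < n" for a i
    using reflexive_simplex_coefficient[OF M refl zero, of i a] that n ix
    by (simp add: I_def del: sum.lessThan_Suc)
  \<comment> \<open>The columns of the Laplacian of \<open>G\<close> sum to zero, so a constant
    added to all coefficients cancels.\<close>
  have shift: "I (\<lambda>i. a i + t) \<longleftrightarrow> I a" for a t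
  proof -
    have "(\<Sum>i<n. (a i + t) * real_of_int (laplacian n E $$ (i, c))) =
        (\<Sum>i<n. a i * real_of_int (laplacian n E $$ (i, c)))" if "c < n - 1" for c
    proof -
      have "(\<Sum>i<n. real_of_int (laplacian n E $$ (i, c))) = 0"
        using laplacian_column_sum[OF G, of c] that by (simp flip: of_int_sum)
      then show ?thesis
        by (simp add: distrib_right sum.distrib flip: sum_distrib_left)
    qed
    then show ?thesis
      by (simp add: I_def)
  qed
  have Icong: "I a \<longleftrightarrow> I b" if "\<And>i. i < n \<Longrightarrow> a i = b i" for a b
    unfolding I_def using that by simp
  have Lam: "a \<in> Lambda M \<longleftrightarrow> a \<in> half_open_cube n \<and> I (\<lambda>i. a $ i) \<and> (\<Sum>i<n. a $ i) \<in> \<int>" for a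
    unfolding M_def Lambda_laplacian_iff[OF n] I_def by simp
  \<comment> \<open>\<open>P a\<close> characterizes the lattice points with coefficients
    \<open>(a, a)\<close>. The factor 2 arises because the column of ones sums over both
    halves.\<close>
  define P where "P a \<longleftrightarrow> a \<in> half_open_cube n \<and> I (\<lambda>i. a $ i) \<and> 2 * (\<Sum>i<n. a $ i) \<in> \<int>"
    for a :: "real vec"
  have dimLn: "dim_row Ln = 2 * n"
    by (simp add: Ln_def L_def delete_column_def laplacian_def)
  have cube_append: "a @\<^sub>v a \<in> half_open_cube (2 * n)" if "a \<in> half_open_cube n" for a
    using that by (auto simp: half_open_cube_def mult_2)
  have points: "fundamental_parallelepiped Ln \<inter> integer_lattice (2 * n) =
      {(a @\<^sub>v a) \<^sub>v* homogenized Ln | a. P a}" (is "?A = ?B")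
  proof (intro Set.set_eqI iffI)
    fix z assume z: "z \<in> ?A"
    then obtain x where x: "z = x \<^sub>v* homogenized Ln" "x \<in> half_open_cube (n + n)"
      by (auto simp: fundamental_parallelepiped_def dimLn mult_2)
    obtain a b where ab: "x = a @\<^sub>v b" "a \<in> half_open_cube n" "b \<in> half_open_cube n"
      using half_open_cube_append[OF x(2)] .
    have carr: "a \<in> carrier_vec n" "b \<in> carrier_vec n"
      using ab by (auto simp: half_open_cube_def)
    note int = whiskered_integral_iff[OF G n carr, folded L_def, folded Ln_def]
    \<comment> \<open>The last \<open>n\<close> columns make each \<open>b $ i - a $ i\<close> an
      integer, and both entries lie in [0,1).\<close>
    have eq: "b = a"
    proof (rule eq_vecI)
      fix i assume "i < dim_vec a"
      then show "b $ i = a $ i"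
        using z x ab int carr by (intro Ints_eq_of_half_open) (auto simp: half_open_cube_def)
    qed (use carr in auto)
    then have "P a"
      using z x ab int by (auto simp: P_def I_def)
    then show "z \<in> ?B"
      using x ab eq by auto
  next
    fix z assume "z \<in> ?B"
    then obtain a where a: "z = (a @\<^sub>v a) \<^sub>v* homogenized Ln" "P a"
      by auto
    have carr: "a \<in> carrier_vec n"
      using a by (auto simp: P_def half_open_cube_def)
    have "z \<in> integer_lattice (2 * n)"
      using whiskered_integral_iff[OF G n carr carr, folded L_def, folded Ln_def] a
      by (auto simp: P_def I_def)
    then show "z \<in> ?A"
      using a cube_append by (auto simp: fundamental_parallelepiped_def dimLn P_def)
  qed
  define h where "h l = l + (1 / (2 * real n)) \<cdot>\<^sub>v vec n (\<lambda>_. 1)" for l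
  have h_append: "(l @\<^sub>v l) + (1 / (2 * real n)) \<cdot>\<^sub>v vec (2 * n) (\<lambda>_. 1) = h l @\<^sub>v h l"
    if "l \<in> half_open_cube n" for l
    using that by (intro eq_vecI) (auto simp: h_def half_open_cube_def mult_2[of n])
  have h_index: "h l $ i = l $ i + 1 / (2 * real n)" if "i < n" for l i
    using that by (simp add: h_def)
  \<comment> \<open>The parameter serves both directions: \<open>t = 1\<close> for \<open>h\<close>
    and \<open>t = -1\<close> for its inverse.\<close>
  have sum_shift: "(\<Sum>i<n. a i + t / (2 * real n)) = (\<Sum>i<n. a i) + t / 2" for a t
    using n by (simp add: sum.distrib)
  have P_iff: "P a \<longleftrightarrow> (\<exists>l\<in>Lambda M. a = l \<or> a = h l)" for a
  proof
    assume P: "P a"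
    then have cube: "a \<in> half_open_cube n" and Ia: "I (\<lambda>i. a $ i)" and "2 * (\<Sum>i<n. a $ i) \<in> \<int>"
      by (auto simp: P_def)
    then obtain k where k: "2 * (\<Sum>i<n. a $ i) = of_int k"
      by (auto elim: Ints_cases)
    show "\<exists>l\<in>Lambda M. a = l \<or> a = h l"
    proof (cases "even k")
      case True
      then obtain m where "k = 2 * m" ..
      then have "(\<Sum>i<n. a $ i) = of_int m"
        using k by simp
      then have "a \<in> Lambda M"
        using cube Ia by (simp add: Lam)
      then show ?thesis
        by blast
    next
      case False
      then obtain m where "k = 2 * m + 1"
        by (rule oddE)
      then have m: "(\<Sum>i<n. a $ i) = of_int m + 1 / 2"
        using k by simp
      define l where "l = vec n (\<lambda>i. a $ i - 1 / (2 * real n))"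
      have "a = h l"
        using cube by (intro eq_vecI) (auto simp: l_def h_def half_open_cube_def)
      moreover have "l \<in> Lambda M"
      proof -
        \<comment> \<open>By \<open>coeff\<close>, \<open>n * a $ i\<close> lies in 1/2 plus the
          integers. Being nonnegative, it is at least 1/2, so subtracting \<open>1 / (2 * n)\<close>
          from \<open>a $ i\<close> keeps it nonnegative.\<close>
        have "0 \<le> l $ i \<and> l $ i < 1" if i: "i < n" for i
        proof -
          obtain r where "(\<Sum>j<n. a $ j) - real n * a $ i = of_int r"
            using coeff[OF Ia i] by (auto elim: Ints_cases)
          then have r: "real n * a $ i = of_int (m - r) + 1 / 2"
            using m by simp
          have "0 \<le> real n * a $ i"
            using cube i by (simp add: half_open_cube_def)
          then have "0 \<le> m - r"
            using r by linarith
          then have "1 / 2 \<le> real n * a $ i"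
            using r by linarith
          then have "1 / (2 * real n) \<le> a $ i"
            using n by (simp add: field_simps)
          moreover have "a $ i < 1"
            using cube i by (simp add: half_open_cube_def)
          moreover have "0 < 1 / (2 * real n)"
            using n by simp
          ultimately have "0 \<le> a $ i - 1 / (2 * real n) \<and> a $ i - 1 / (2 * real n) < 1"
            by linarith
          then show ?thesis
            using i by (simp add: l_def)
        qed
        then have "l \<in> half_open_cube n"
          by (simp add: half_open_cube_def l_def)
        moreover have "I (\<lambda>i. l $ i)"
          using Ia shift[of "\<lambda>i. a $ i" "- 1 / (2 * real n)"]
            Icong[of "\<lambda>i. l $ i" "\<lambda>i. a $ i + (- 1 / (2 * real n))"] by (simp add: l_def)
        moreover have "(\<Sum>i<n. l $ i) = of_int m"
          using sum_shift[of "\<lambda>i. a $ i" "-1"] m by (simp add: l_def)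
        ultimately show ?thesis
          by (simp add: Lam)
      qed
      ultimately show ?thesis
        by blast
    qed
  next
    assume "\<exists>l\<in>Lambda M. a = l \<or> a = h l"
    then obtain l where l: "l \<in> Lambda M" "a = l \<or> a = h l"
      by blast
    then have cube: "l \<in> half_open_cube n" and Il: "I (\<lambda>i. l $ i)" and S: "(\<Sum>i<n. l $ i) \<in> \<int>"
      by (auto simp: Lam)
    have "P l"
      using cube Il S by (simp add: P_def)
    moreover have "P (h l)"
    proof -
      \<comment> \<open>Here \<open>n * l $ i\<close> is an integer below \<open>n\<close>, hence at
        most \<open>n - 1\<close>, which leaves room for the added 1/2.\<close>
      have "0 \<le> h l $ i \<and> h l $ i < 1" if i: "i < n" for i
      proof -
        have "real n * l $ i \<in> \<int>"
          using Ints_diff[OF S coeff[OF Il i]] by simp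
        then obtain r where r: "real n * l $ i = of_int r"
          by (auto elim: Ints_cases)
        have l01: "0 \<le> l $ i" "l $ i < 1"
          using cube i by (auto simp: half_open_cube_def)
        then have "real n * l $ i < real n"
          using n by simp
        then have "r + 1 \<le> int n"
          using r by linarith
        then have "real n * l $ i + 1 / 2 < real n"
          using r by linarith
        then have "l $ i + 1 / (2 * real n) < 1"
          using n by (simp add: field_simps)
        then show ?thesis
          using l01 i by (simp add: h_index)
      qed
      then have "h l \<in> half_open_cube n"
        using cube by (simp add: half_open_cube_def h_def)
      moreover have "I (\<lambda>i. h l $ i)"
        using Il shift[of "\<lambda>i. l $ i" "1 / (2 * real n)"]
          Icong[of "\<lambda>i. h l $ i" "\<lambda>i. l $ i + 1 / (2 * real n)"] h_index by simp
      moreover have "2 * (\<Sum>i<n. h l $ i) = 2 * (\<Sum>i<n. l $ i) + 1"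
        using sum_shift[of "\<lambda>i. l $ i" 1] h_index by simp
      ultimately show ?thesis
        using S by (simp add: P_def)
    qed
    ultimately show "P a"
      using l by auto
  qed
  have "{(a @\<^sub>v a) \<^sub>v* homogenized Ln | a. P a} =
      (\<Union>l\<in>Lambda M. {(l @\<^sub>v l) \<^sub>v* homogenized Ln, (h l @\<^sub>v h l) \<^sub>v* homogenized Ln})"
    unfolding P_iff by blast
  also have "\<dots> = (\<Union>l\<in>Lambda M. {(l @\<^sub>v l) \<^sub>v* homogenized Ln,
        ((l @\<^sub>v l) + (1 / (2 * real n)) \<cdot>\<^sub>v vec (2 * n) (\<lambda>_. 1)) \<^sub>v* homogenized Ln})"
    using h_append by (intro SUP_cong) (auto simp: Lam)
  finally show ?thesis
    unfolding points M_def .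
qed

end
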